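(* Let $f\ge 0$ be a nonnegative integer and let $N\ge 1$ be a positive integer. Let $$P_N(q,x)=\sum_{d\ge 0} (-1)^{f d}\,\frac{q^{\frac{1}{2}f(d^2-d)}}{(q;q)_d}\, x^{Nd}.$$ Then $$\frac{P_N(q,qx)}{P_N(q,x)}=1+\sum_{n>0} a^{(N)}_n(q)\, x^{Nn},$$ where, for every $n\ge 1$, the coefficient $a^{(N)}_n(q)$ is given by $$a^{(N)}_n(q)=(-1)^{(f-1)n}\sum_{c_1=0}^{N-1}\;\sum_{c_2=0}^{c_1+f-1}\;\sum_{c_3=0}^{c_2+f-1}\cdots\sum_{c_n=0}^{c_{n-1}+f-1} q^{c_1+c_2+\cdots+c_{n}}.$$
   Context: $(q;q)_d=\prod_{k=1}^{d}(1-q^k)$ is the $q$-Pochhammer symbol, with $(q;q)_0=1$. The series are regarded as formal power series in $x$ with coefficients in the field of rational functions of the indeterminate $q$; $P_N(q,qx)$ denotes the series obtained by substituting $qx$ for $x$. The series $P_N(q,x)$ is the quiver generating series of the quiver with a single vertex, $f$ loops, and one generator of level $N$. A sum $\sum_{c=0}^{-1}$ is empty and equals $0$. *)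

theory Defs
  imports "HOL-Computational_Algebra.Computational_Algebra"
begin

definition q_indet :: "'k::field poly fract" where
  "q_indet = Fract [:0, 1:] 1"

definition q_poch :: "'a::field \<Rightarrow> nat \<Rightarrow> 'a" where
  "q_poch q d = (\<Prod>k=1..d. 1 - q ^ k)"

text \<open>Composition with \<open>fps_X ^ N\<close> turns \<open>\<Sum>d. u d * x ^ d\<close> into \<open>\<Sum>d. u d * x ^ (N * d)\<close>; this needs
  \<open>N \<ge> 1\<close>. The natural number subtraction and division are exact.\<close>

definition quiver_series :: "nat \<Rightarrow> nat \<Rightarrow> 'a::field \<Rightarrow> 'a fps" where
  "quiver_series f N q =
     Abs_fps (\<lambda>d. (-1) ^ (f * d) * (q ^ ((f * (d\<^sup>2 - d)) div 2) / q_poch q d)) oo fps_X ^ N"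

text \<open>\<open>nested_sum f q n b s\<close> is the \<open>n\<close>-fold nested sum of \<open>q ^ (s + c\<^sub>1 + \<dots> + c\<^sub>n)\<close> over
  \<open>0 \<le> c\<^sub>1 < b\<close> and \<open>0 \<le> c\<^sub>k < c\<^sub>k\<^sub>-\<^sub>1 + f\<close> for \<open>k = 2, \<dots>, n\<close>. The strict bounds express the
  upper summation limits \<open>b - 1\<close> and \<open>c\<^sub>k\<^sub>-\<^sub>1 + f - 1\<close> without subtraction, so that an upper
  limit \<open>-1\<close> gives the empty sum.\<close>

fun nested_sum :: "nat \<Rightarrow> 'a::field \<Rightarrow> nat \<Rightarrow> nat \<Rightarrow> nat \<Rightarrow> 'a" where
  "nested_sum f q 0 b s = q ^ s"
| "nested_sum f q (Suc n) b s = (\<Sum>c<b. nested_sum f q n (c + f) (s + c))"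

text \<open>The exponent \<open>(f - 1) * n\<close> of the sign is an integer, negative for \<open>f = 0\<close>.\<close>

definition ratio_coeff :: "nat \<Rightarrow> nat \<Rightarrow> 'a::field \<Rightarrow> nat \<Rightarrow> 'a" where
  "ratio_coeff f N q n = (-1) powi ((int f - 1) * int n) * nested_sum f q n N 0"

end

theory Submission
  imports Defs
begin

text \<open>Put \<open>y = x ^ N\<close> and let \<open>P\<close> be the series with \<open>N = 1\<close>. Comparing coefficients gives the
  functional equation \<open>P(y) - P(q y) = (-1) ^ f * y * P(q ^ f * y)\<close>. Replacing \<open>y\<close> by
  \<open>q ^ c * y\<close> and telescoping over \<open>c < b\<close>, the quotients \<open>R\<^sub>b(y) = P(q ^ b * y) / P(y)\<close> satisfy
  \<open>R\<^sub>b = 1 - (-1) ^ f * y * (\<Sum>c<b. q ^ c * R\<^sub>c\<^sub>+\<^sub>f)\<close>, which is the recursion of the nested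
  sums. The theorem is the case \<open>b = N\<close>.\<close>

definition quiver_base :: "nat \<Rightarrow> 'a::field \<Rightarrow> 'a fps" where
  "quiver_base f q =
     Abs_fps (\<lambda>d. (-1) ^ (f * d) * (q ^ ((f * (d\<^sup>2 - d)) div 2) / q_poch q d))"

lemma quiver_base_nth_0 [simp]: "quiver_base f q $ 0 = 1"
  by (simp add: quiver_base_def q_poch_def)

lemma q_poch_Suc: "q_poch q (Suc d) = q_poch q d * (1 - q ^ Suc d)"
  by (simp add: q_poch_def)

text \<open>From \<open>d\<close> to \<open>Suc d\<close> the exponent of \<open>q\<close> grows by
  \<open>f * d\<close>, and the q-Pochhammer symbol gains the factor \<open>1 - q ^ Suc d\<close>,
  which is nonzero by assumption.\<close>

lemma quiver_base_nth_Suc: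
  fixes q :: "'a::field"
  assumes "q ^ Suc d \<noteq> 1"
  shows "(1 - q ^ Suc d) * quiver_base f q $ Suc d = (-1) ^ f * q ^ (f * d) * quiver_base f q $ d"
proof -
  \<comment> \<open>The exponents are compared before halving; the case split on \<open>d\<close>
    disposes of the truncated subtraction.\<close>
  have "f * ((Suc d)\<^sup>2 - Suc d) = f * (d\<^sup>2 - d) + f * d * 2"
    by (cases d) (simp_all add: power2_eq_square algebra_simps)
  hence "(f * ((Suc d)\<^sup>2 - Suc d)) div 2 = (f * (d\<^sup>2 - d)) div 2 + f * d"
    by simp
  thus ?thesis
    using assms by (simp add: quiver_base_def q_poch_Suc power_add)
qed

text \<open>On the left, the coefficient of index \<open>Suc d\<close> carries the factor
  \<open>1 - q ^ Suc d\<close>, which the recurrence trades for the coefficient of index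
  \<open>d\<close>.\<close>

lemma quiver_base_scale_diff:
  fixes q :: "'a::field"
  assumes "\<And>d. q ^ Suc d \<noteq> 1"
  shows "(quiver_base f q oo (fps_const (q ^ c) * fps_X))
           - (quiver_base f q oo (fps_const (q ^ Suc c) * fps_X))
         = fps_const ((-1) ^ f * q ^ c) * fps_X
           * (quiver_base f q oo (fps_const (q ^ (c + f)) * fps_X))" (is "?l = ?r")
proof (rule fps_ext)
  fix n show "?l $ n = ?r $ n"
  proof (cases n)
    case (Suc d)
    have "(q ^ Suc c) ^ Suc d = (q ^ c) ^ Suc d * q ^ Suc d"
      by (simp only: power_Suc2[of q c] power_mult_distrib)
    hence "?l $ n = (q ^ c) ^ Suc d * ((1 - q ^ Suc d) * quiver_base f q $ Suc d)"
      by (simp only: Suc fps_nth_compose_linear fps_sub_nth) (simp only: algebra_simps mult_1_left)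
    also have "\<dots> = (q ^ c) ^ Suc d * ((-1) ^ f * q ^ (f * d) * quiver_base f q $ d)"
      by (simp only: quiver_base_nth_Suc[OF assms])
    also have "\<dots> = (-1) ^ f * q ^ c * ((q ^ (c + f)) ^ d * quiver_base f q $ d)"
      by (simp add: power_add power_mult_distrib power_mult)
    also have "\<dots> = ?r $ n"
      by (simp add: Suc mult.assoc)
    finally show ?thesis .
  qed (simp add: fps_nth_compose_linear mult.assoc)
qed

lemma quiver_base_scale:
  fixes q :: "'a::field"
  assumes "\<And>d. q ^ Suc d \<noteq> 1"
  shows "quiver_base f q oo (fps_const (q ^ b) * fps_X)
         = quiver_base f q - fps_const ((-1) ^ f) * fps_X
           * (\<Sum>c<b. fps_const (q ^ c) * (quiver_base f q oo (fps_const (q ^ (c + f)) * fps_X)))"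
proof (induction b)
  case (Suc b)
  show ?case
    using quiver_base_scale_diff[OF assms, of f b] Suc
    by (simp add: algebra_simps flip: fps_const_mult)
qed simp

text \<open>The accumulator \<open>s\<close> only adds to the exponent. Pulling it out turns the
  outermost index \<open>c\<close> into the weight \<open>q ^ c\<close>.\<close>

lemma nested_sum_shift: "nested_sum f q n b s = q ^ s * nested_sum f q n b 0"
proof (induction n arbitrary: b s)
  case (Suc n)
  have "nested_sum f q n (c + f) (s + c) = q ^ s * nested_sum f q n (c + f) c" for c
    using Suc[of "c + f" "s + c"] Suc[of "c + f" c] by (simp add: power_add)
  thus ?case by (simp add: sum_distrib_left)
qed simp

text \<open>Trades the integer exponent, negative for \<open>f = 0\<close>, for a natural power of
  the sign that occurs in the functional equation.\<close>

lemma ratio_coeff_eq: "ratio_coeff f b q n = (- ((-1) ^ f)) ^ n * nested_sum f q n b 0"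
proof -
  have "(-1 :: 'a) powi (int f - 1) = - ((-1) ^ f)"
    by (simp add: power_int_diff)
  thus ?thesis
    by (simp add: ratio_coeff_def power_int_mult)
qed

lemma ratio_coeff_Suc:
  "ratio_coeff f b q (Suc n) = - ((-1) ^ f) * (\<Sum>c<b. q ^ c * ratio_coeff f (c + f) q n)"
proof -
  have "nested_sum f q (Suc n) b 0 = (\<Sum>c<b. q ^ c * nested_sum f q n (c + f) 0)"
    by (simp add: nested_sum_shift[symmetric])
  thus ?thesis
    by (simp add: ratio_coeff_eq sum_distrib_left mult_ac del: nested_sum.simps)
qed

lemma ratio_coeff_0 [simp]: "ratio_coeff f b q 0 = 1"
  by (simp add: ratio_coeff_eq)

text \<open>The factor \<open>fps_X\<close> in the functional equation ties coefficient
  \<open>Suc n\<close> of one quotient to coefficients \<open>n\<close> of others, exactly as in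
  \<open>ratio_coeff_Suc\<close>; both recursions start at 1.\<close>

lemma quiver_base_ratio:
  fixes q :: "'a::field"
  assumes "\<And>d. q ^ Suc d \<noteq> 1"
  shows "(quiver_base f q oo (fps_const (q ^ b) * fps_X)) / quiver_base f q
         = Abs_fps (ratio_coeff f b q)"
proof (rule fps_ext)
  define P where "P = quiver_base f q"
  define R where "R b = (P oo (fps_const (q ^ b) * fps_X)) / P" for b
  have P0: "P $ 0 \<noteq> 0" by (simp add: P_def)
  have scale: "P oo (fps_const (q ^ b) * fps_X) = R b * P" for b
    using P0 by (simp add: R_def fps_divide_unit mult.assoc inverse_mult_eq_1)
  define S where
    "S b = 1 - fps_const ((-1) ^ f) * fps_X * (\<Sum>c<b. fps_const (q ^ c) * R (c + f))" for b
  have "R b * P = S b * P" for b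
    unfolding S_def using quiver_base_scale[OF assms, of f b, folded P_def, unfolded scale]
    by (simp only: left_diff_distrib sum_distrib_right mult.assoc mult_1_left)
  moreover have "P \<noteq> 0" using P0 by auto
  ultimately have rec: "R b = S b" for b by simp
  fix n
  have "R b $ n = ratio_coeff f b q n"
  \<comment> \<open>\<open>b\<close> must vary, because the recursion leads from \<open>R b\<close>
    to \<open>R (c + f)\<close>.\<close>
  proof (induction n arbitrary: b)
    case 0
    show ?case by (subst rec) (simp add: S_def mult.assoc)
  next
    case (Suc n)
    show ?case by (subst rec) (simp add: S_def Suc fps_sum_nth mult.assoc ratio_coeff_Suc)
  qed
  thus "((quiver_base f q oo (fps_const (q ^ b) * fps_X)) / quiver_base f q) $ n
          = Abs_fps (ratio_coeff f b q) $ n"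
    by (simp add: R_def P_def)
qed

lemma q_indet_power: "(q_indet :: 'k::field poly fract) ^ n = Fract (monom 1 n) 1"
  by (induction n) (simp_all add: q_indet_def One_fract_def monom_Suc flip: One_fract_def)

text \<open>A positive power of the indeterminate is a monomial of positive degree, hence not
  constant. So no factor of the q-Pochhammer symbol vanishes.\<close>

lemma q_indet_power_neq_1: "(q_indet :: 'k::field poly fract) ^ Suc n \<noteq> 1"
proof
  assume "(q_indet :: 'k poly fract) ^ Suc n = 1"
  hence "monom (1 :: 'k) (Suc n) = 1"
    unfolding q_indet_power One_fract_def by (simp add: eq_fract)
  hence "degree (monom (1 :: 'k) (Suc n)) = 0" by simp
  thus False by (simp add: degree_monom_eq)
qed

theorem proposition2:
  fixes f N :: nat
  assumes "N \<ge> 1"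
  shows "(quiver_series f N q_indet oo (fps_const q_indet * fps_X)) / quiver_series f N q_indet
       = 1 + (Abs_fps (\<lambda>n. if n = 0 then 0 else ratio_coeff f N q_indet n) oo fps_X ^ N
                :: 'k::field poly fract fps)"
proof -
  define q where "q = (q_indet :: 'k poly fract)"
  define P where "P = quiver_base f q"
  define R where "R = Abs_fps (ratio_coeff f N q)"
  define Y where "Y = (fps_X ^ N :: 'k poly fract fps)"
  \<comment> \<open>The laws for composition ask for inner series with zero constant term;
    \<open>N \<ge> 1\<close> provides it.\<close>
  have Y0: "Y $ 0 = 0" using assms by (simp add: Y_def)
  have P0: "(P oo Y) $ 0 \<noteq> 0" by (simp add: P_def)
  \<comment> \<open>Scaling \<open>x\<close> by \<open>q\<close> scales \<open>x ^ N\<close> by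
    \<open>q ^ N\<close>, which is why \<open>b = N\<close> is the relevant quotient.\<close>
  have YqX: "Y oo (fps_const q * fps_X) = (fps_const (q ^ N) * fps_X) oo Y"
  proof -
    have "Y oo (fps_const q * fps_X) = (fps_const q * fps_X) ^ N"
      by (simp add: Y_def fps_compose_power[symmetric])
    also have "\<dots> = fps_const (q ^ N) * Y"
      by (simp add: Y_def power_mult_distrib)
    also have "\<dots> = (fps_const (q ^ N) * fps_X) oo Y"
      using Y0 by (simp add: fps_compose_mult_distrib)
    finally show ?thesis .
  qed
  have "(P oo Y) oo (fps_const q * fps_X) = P oo (Y oo (fps_const q * fps_X))"
    using Y0 by (simp add: fps_compose_assoc)
  also have "\<dots> = (P oo (fps_const (q ^ N) * fps_X)) oo Y"
    using Y0 by (simp add: YqX fps_compose_assoc)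
  \<comment> \<open>The quotient is written as a product, over which composition with
    \<open>Y\<close> distributes.\<close>
  also have "P oo (fps_const (q ^ N) * fps_X) = R * P"
  proof -
    have "P oo (fps_const (q ^ N) * fps_X) = (P oo (fps_const (q ^ N) * fps_X)) / P * P"
      by (simp add: P_def fps_divide_unit mult.assoc inverse_mult_eq_1)
    also have "(P oo (fps_const (q ^ N) * fps_X)) / P = R"
      unfolding P_def R_def q_def by (rule quiver_base_ratio[OF q_indet_power_neq_1])
    finally show ?thesis .
  qed
  also have "(R * P) oo Y = (R oo Y) * (P oo Y)"
    using Y0 by (rule fps_compose_mult_distrib)
  finally have "((P oo Y) oo (fps_const q * fps_X)) / (P oo Y) = R oo Y"
    using P0 by (simp add: fps_divide_unit mult.assoc inverse_mult_eq_1')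
  also have "R = 1 + Abs_fps (\<lambda>n. if n = 0 then 0 else ratio_coeff f N q n)"
    by (rule fps_ext) (simp add: R_def)
  also have "\<dots> oo Y = 1 + (Abs_fps (\<lambda>n. if n = 0 then 0 else ratio_coeff f N q n) oo Y)"
    by (simp add: fps_compose_add_distrib)
  finally show ?thesis
    unfolding P_def quiver_base_def Y_def q_def quiver_series_def[symmetric] .
qed

end
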